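(* For nonzero parameters $a,b,c\in\mathbb C$, the map $$T_{a,b,c}:(x_1,x_2,y_1,y_2,z_1,z_2)\mapsto\left(y_1,\ \frac{ax_1^2x_2y_2}{(ay_1y_2+bx_1^2x_2z_2)z_1},\ x_1,\ \frac{bx_2z_1z_2}{ac},\ \frac{y_1z_1}{x_1},\ \frac{ay_1y_2+bx_1^2x_2z_2}{ax_1x_2y_1}\right)$$ can be restricted, on a level set of its invariants $I_1=x_1+y_1$, $I_2=y_1z_1$, $I_3=\frac{x_1}{z_1}$, to the three-dimensional noninvolutive parametric tetrahedron map $$(x,y,z)\mapsto\left(\frac{axy}{ay+bxz},\ \frac{bxz}{ac},\ \frac{ay+bxz}{ax}\right).$$
   Context: All maps are rational maps and identities between them are understood as identities of rational functions. "Can be restricted on a level set of its invariants" means: there are constants $k_1,k_2,k_3$ (independent of $a,b,c$) such that $T_{a,b,c}$ maps the common level set $\{I_1=k_1,I_2=k_2,I_3=k_3\}$ to itself and, in suitable coordinates $(x,y,z)$ on this level set (independent of $a,b,c$), the induced map is the displayed one. Noninvolutive means that the composition of the map with itself is not the identity. Parametric tetrahedron map: a family of rational maps $S_{a,b,c}:\mathcal X^3\to\mathcal X^3$ is a parametric tetrahedron map if $$S^{123}_{a,b,c}\circ S^{145}_{a,d,e}\circ S^{246}_{b,d,f}\circ S^{356}_{c,e,f}=S^{356}_{c,e,f}\circ S^{246}_{b,d,f}\circ S^{145}_{a,d,e}\circ S^{123}_{a,b,c}$$ on $\mathcal X^6$ for all parameters $a,b,c,d,e,f$, where $S^{ijk}$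 acts as $S$ on the $i$-th, $j$-th, $k$-th factors (in this order) of $\mathcal X^6$ and as the identity on the others. For the three-dimensional map, $\mathcal X=\mathbb C$. *)

theory Defs
  imports
    "HOL-Analysis.Analysis"
    "HOL-Library.Poly_Mapping"
    "HOL-Library.Numeral_Type"
    "HOL-Computational_Algebra.Fraction_Field"
begin

section \<open>Rational functions and rational maps over the complex numbers\<close>

text \<open>
  Polynomials are finitely supported maps from monomials (exponent vectors) to coefficients.
  The type \<open>'n ratfun\<close> is the field of rational functions in the indeterminates indexed by
  the finite type \<open>'n\<close>, and a rational map from \<open>\<complex>\<^sup>n\<close> to \<open>\<complex>\<^sup>m\<close> is an \<open>m\<close>-tuple of
  such functions. Equality in these types is thus identity of rational functions.
\<close>

type_synonym 'n cpoly = "('n \<Rightarrow>\<^sub>0 nat) \<Rightarrow>\<^sub>0 complex"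
type_synonym 'n ratfun = "'n cpoly fract"
type_synonym ('n, 'm) ratmap = "('n ratfun) ^ 'm"

definition Cst :: "complex \<Rightarrow> ('n :: {finite, linorder}) ratfun" where
  "Cst c = Fract (Poly_Mapping.single 0 c) 1"

definition Var :: "'n \<Rightarrow> ('n :: {finite, linorder}) ratfun" where
  "Var i = Fract (Poly_Mapping.single (Poly_Mapping.single i 1) 1) 1"

text \<open>
  Evaluation takes values in a field \<open>'k\<close> containing the complex numbers via \<open>h\<close>. Below
  it is used with \<open>h = id\<close> (values at points) and with \<open>h = Cst\<close> (substitution of rational
  functions for the indeterminates).
\<close>

definition poly_eval :: "(complex \<Rightarrow> 'k :: field) \<Rightarrow> 'k ^ ('n :: {finite, linorder}) \<Rightarrow> 'n cpoly \<Rightarrow> 'k" where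
  "poly_eval h v P =
     (\<Sum>m \<in> Poly_Mapping.keys P.
        h (Poly_Mapping.lookup P m) * (\<Prod>i \<in> UNIV. v $ i ^ Poly_Mapping.lookup m i))"

text \<open>
  A rational function need not be given in lowest terms: it is defined at \<open>v\<close> as soon as one
  of its representations has a denominator that does not vanish at \<open>v\<close>. All such
  representations give the same value.
\<close>

definition rf_defined :: "(complex \<Rightarrow> 'k :: field) \<Rightarrow> 'k ^ ('n :: {finite, linorder}) \<Rightarrow> 'n ratfun \<Rightarrow> bool" where
  "rf_defined h v r \<longleftrightarrow> (\<exists>P Q. r = Fract P Q \<and> poly_eval h v Q \<noteq> 0)"

definition rf_value :: "(complex \<Rightarrow> 'k :: field) \<Rightarrow> 'k ^ ('n :: {finite, linorder}) \<Rightarrow> 'n ratfun \<Rightarrow> 'k" where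
  "rf_value h v r =
     (THE w. \<exists>P Q. r = Fract P Q \<and> poly_eval h v Q \<noteq> 0 \<and> w = poly_eval h v P / poly_eval h v Q)"

definition regular_at :: "('n :: {finite, linorder}, 'm :: finite) ratmap \<Rightarrow> complex ^ ('n :: _) \<Rightarrow> bool" where
  "regular_at f p \<longleftrightarrow> (\<forall>i. rf_defined id p (f $ i))"

definition value_at :: "('n :: {finite, linorder}, 'm :: finite) ratmap \<Rightarrow> complex ^ ('n :: _) \<Rightarrow> complex ^ 'm" where
  "value_at f p = (\<chi> i. rf_value id p (f $ i))"

text \<open>
  The composite of two rational maps exists only if the image of the inner map is not contained
  in the indeterminacy locus of the outer one.
\<close>

definition composable :: "('n :: {finite, linorder}, 'm :: finite) ratmap \<Rightarrow>
    ('l :: {finite, linorder}, 'n) ratmap \<Rightarrow> bool" where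
  "composable f g \<longleftrightarrow> (\<forall>i. rf_defined Cst g (f $ i))"

definition rcomp :: "('n :: {finite, linorder}, 'm :: finite) ratmap \<Rightarrow>
    ('l :: {finite, linorder}, 'n) ratmap \<Rightarrow> ('l, 'm) ratmap" (infixr "\<circ>\<^sub>r" 55) where
  "f \<circ>\<^sub>r g = (\<chi> i. rf_value Cst g (f $ i))"

definition rid :: "('n :: {finite, linorder}, 'n) ratmap" where
  "rid = (\<chi> i. Var i)"

definition noninvolutive :: "('n :: {finite, linorder}, 'n) ratmap \<Rightarrow> bool" where
  "noninvolutive f \<longleftrightarrow> composable f f \<and> f \<circ>\<^sub>r f \<noteq> rid"


section \<open>Parametric tetrahedron maps\<close>

text \<open>
  The action of a rational map of \<open>\<complex>\<^sup>3\<close> on the factors \<open>i, j, k\<close> of \<open>\<complex>\<^sup>6\<close>. The coordinates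
  are numbered from 1 to 6; in the index type of size six, \<open>6\<close> is another name for \<open>0\<close>.
\<close>

definition act_on :: "(3, 3) ratmap \<Rightarrow> 6 \<Rightarrow> 6 \<Rightarrow> 6 \<Rightarrow> (6, 6) ratmap" where
  "act_on S i j k =
     (let S' = S \<circ>\<^sub>r vector [Var i, Var j, Var k]
      in \<chi> l. if l = i then S' $ 1 else if l = j then S' $ 2 else if l = k then S' $ 3 else Var l)"

text \<open>\<open>parametric_tetrahedron_map P S\<close>: the parameters range over \<open>P\<close>, and \<open>\<X> = \<complex>\<close>.\<close>

definition parametric_tetrahedron_map ::
  "complex set \<Rightarrow> (complex \<Rightarrow> complex \<Rightarrow> complex \<Rightarrow> (3, 3) ratmap) \<Rightarrow> bool" where
  "parametric_tetrahedron_map P S \<longleftrightarrow>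
     (\<forall>a\<in>P. \<forall>b\<in>P. \<forall>c\<in>P. \<forall>d\<in>P. \<forall>e\<in>P. \<forall>f\<in>P.
        let S123 = act_on (S a b c) 1 2 3;
            S145 = act_on (S a d e) 1 4 5;
            S246 = act_on (S b d f) 2 4 6;
            S356 = act_on (S c e f) 3 5 6
        in composable S246 S356 \<and>
           composable S145 (S246 \<circ>\<^sub>r S356) \<and>
           composable S123 (S145 \<circ>\<^sub>r S246 \<circ>\<^sub>r S356) \<and>
           composable S145 S123 \<and>
           composable S246 (S145 \<circ>\<^sub>r S123) \<and>
           composable S356 (S246 \<circ>\<^sub>r S145 \<circ>\<^sub>r S123) \<and>
           S123 \<circ>\<^sub>r S145 \<circ>\<^sub>r S246 \<circ>\<^sub>r S356 = S356 \<circ>\<^sub>r S246 \<circ>\<^sub>r S145 \<circ>\<^sub>r S123)"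


section \<open>Invariants, level sets and restrictions\<close>

definition invariants_of :: "('n :: {finite, linorder}, 'm :: finite) ratmap \<Rightarrow> ('n, 'n) ratmap \<Rightarrow> bool" where
  "invariants_of I T \<longleftrightarrow> composable I T \<and> I \<circ>\<^sub>r T = I"

definition level_set :: "('n :: {finite, linorder}, 'm :: finite) ratmap \<Rightarrow> complex ^ 'm \<Rightarrow> (complex ^ ('n :: _)) set" where
  "level_set I k = {p. regular_at I p \<and> value_at I p = k}"

text \<open>
  Coordinates on \<open>L\<close>: a parametrization \<open>\<phi>\<close> of \<open>L\<close> by affine space and its inverse \<open>\<psi>\<close>, both
  given by everywhere defined rational functions.
\<close>

definition coordinates_on :: "(complex ^ ('n :: {finite, linorder})) set \<Rightarrow> ('d :: {finite, linorder}, 'n) ratmap \<Rightarrow>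
    ('n :: {finite, linorder}, 'd) ratmap \<Rightarrow> bool" where
  "coordinates_on L \<phi> \<psi> \<longleftrightarrow>
     (\<forall>u. regular_at \<phi> u \<and> value_at \<phi> u \<in> L \<and> value_at \<psi> (value_at \<phi> u) = u) \<and>
     (\<forall>p\<in>L. regular_at \<psi> p \<and> value_at \<phi> (value_at \<psi> p) = p)"

text \<open>
  \<open>T\<close> maps \<open>L\<close> to itself, as far as it is defined there, and the induced map is \<open>S\<close> in the
  coordinates \<open>\<phi>, \<psi>\<close>. Composability of \<open>T\<close> and \<open>\<phi>\<close> says that \<open>T\<close> is defined at generic points
  of \<open>L\<close>.
\<close>

definition restricts_to :: "('n :: {finite, linorder}, 'n) ratmap \<Rightarrow> (complex ^ ('n :: _)) set \<Rightarrow>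
    ('d :: {finite, linorder}, 'n) ratmap \<Rightarrow> ('n, 'd) ratmap \<Rightarrow> ('d, 'd) ratmap \<Rightarrow> bool" where
  "restricts_to T L \<phi> \<psi> S \<longleftrightarrow>
     (\<forall>p\<in>L. regular_at T p \<longrightarrow> value_at T p \<in> L) \<and>
     composable T \<phi> \<and> composable \<psi> (T \<circ>\<^sub>r \<phi>) \<and> \<psi> \<circ>\<^sub>r T \<circ>\<^sub>r \<phi> = S"


section \<open>The maps\<close>

text \<open>The six variables are ordered as \<open>x\<^sub>1, x\<^sub>2, y\<^sub>1, y\<^sub>2, z\<^sub>1, z\<^sub>2\<close>.\<close>

definition Tmap :: "complex \<Rightarrow> complex \<Rightarrow> complex \<Rightarrow> (6, 6) ratmap" where
  "Tmap a b c =
     (let x1 = Var 1; x2 = Var 2; y1 = Var 3; y2 = Var 4; z1 = Var 5; z2 = Var 6;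
          A = Cst a; B = Cst b; C = Cst c
      in vector
           [y1,
            (A * x1^2 * x2 * y2) / ((A * y1 * y2 + B * x1^2 * x2 * z2) * z1),
            x1,
            (B * x2 * z1 * z2) / (A * C),
            (y1 * z1) / x1,
            (A * y1 * y2 + B * x1^2 * x2 * z2) / (A * x1 * x2 * y1)])"

definition Inv :: "(6, 3) ratmap" where
  "Inv =
     (let x1 = Var 1; y1 = Var 3; z1 = Var 5
      in vector [x1 + y1, y1 * z1, x1 / z1])"

definition Smap :: "complex \<Rightarrow> complex \<Rightarrow> complex \<Rightarrow> (3, 3) ratmap" where
  "Smap a b c =
     (let x = Var 1; y = Var 2; z = Var 3;
          A = Cst a; B = Cst b; C = Cst c
      in vector
           [(A * x * y) / (A * y + B * x * z),
            (B * x * z) / (A * C),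
            (A * y + B * x * z) / (A * x)])"

end

theory Submission
  imports Defs
begin

text \<open>
  For \<open>k = (2, 1, 1)\<close> the level set is the affine space \<open>x\<^sub>1 = y\<^sub>1 = z\<^sub>1 = 1\<close>: eliminating
  \<open>x\<^sub>1\<close> and \<open>y\<^sub>1\<close> leaves the quadratic \<open>(z\<^sub>1 - 1)\<^sup>2 = 0\<close>. On it \<open>T\<close> acts on \<open>(x\<^sub>2, y\<^sub>2, z\<^sub>2)\<close> as \<open>S\<close>.

  With \<open>D = y/x + (b/a) z\<close> the map \<open>S\<close> becomes \<open>(x, y, z) \<mapsto> (y/D, (b/ac) x z, D)\<close>, so the tetrahedron
  equation comes down to three identities between the four denominators \<open>D\<close> met on either side.
  The denominators are nonzero rational functions because they do not vanish at one suitable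
  point, at which the parameters almost cancel. If \<open>S \<circ> S\<close> were the identity, comparing first
  components would give \<open>z = D (xz/y + c)\<close>, which fails at \<open>(1, 1, 0)\<close>.
\<close>

section \<open>Polynomial evaluation along a ring homomorphism from the complex numbers to a
  field\<close>

locale complex_field_hom =
  fixes h :: "complex \<Rightarrow> 'k :: field"
  assumes hom_add: "h (x + y) = h x + h y"
    and hom_mult: "h (x * y) = h x * h y"
    and hom_one: "h 1 = 1"
begin

lemma hom_zero: "h 0 = 0"
  using hom_add[of 0 0] by (metis add.right_neutral add_cancel_right_right)

text \<open>Monomials outside the support have coefficient 0, which \<open>h\<close> sends to 0.
  This lets polynomials with different supports be summed over one index set.\<close>

lemma poly_eval_superset:
  assumes "finite M" "Poly_Mapping.keys P \<subseteq> M"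
  shows "poly_eval h v P =
    (\<Sum>m \<in> M. h (Poly_Mapping.lookup P m) * (\<Prod>i \<in> UNIV. v $ i ^ Poly_Mapping.lookup m i))"
  unfolding poly_eval_def
  by (rule sum.mono_neutral_left) (use assms in \<open>auto simp: hom_zero in_keys_iff\<close>)

lemma poly_eval_single:
  "poly_eval h v (Poly_Mapping.single m c) = h c * (\<Prod>i \<in> UNIV. v $ i ^ Poly_Mapping.lookup m i)"
  by (subst poly_eval_superset[where M = "{m}"]) auto

lemma poly_eval_add: "poly_eval h v (P + Q) = poly_eval h v P + poly_eval h v Q"
proof -
  let ?M = "Poly_Mapping.keys P \<union> Poly_Mapping.keys Q"
  have "Poly_Mapping.keys (P + Q) \<subseteq> ?M" by (rule Poly_Mapping.keys_add)
  then show ?thesis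
    by (simp add: poly_eval_superset[of ?M] lookup_add hom_add ring_distribs sum.distrib)
qed

lemma poly_eval_zero: "poly_eval h v 0 = 0"
  by (simp add: poly_eval_def)

lemma poly_eval_sum: "poly_eval h v (\<Sum>x\<in>A. f x) = (\<Sum>x\<in>A. poly_eval h v (f x))"
  by (induction A rule: infinite_finite_induct) (auto simp: poly_eval_zero poly_eval_add)

lemma poly_eval_mult: "poly_eval h v (P * Q) = poly_eval h v P * poly_eval h v Q"
proof -
  \<comment> \<open>Expanding both factors into single monomials reduces the claim to the case where
    exponents add and \<open>h\<close> is multiplicative.\<close>
  have expand: "R = (\<Sum>m\<in>Poly_Mapping.keys R. Poly_Mapping.single m (Poly_Mapping.lookup R m))"
    for R :: "'a cpoly"
    by (rule poly_mapping_eqI) (simp add: lookup_sum lookup_single when_def in_keys_iff)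
  have "poly_eval h v (P * Q) = poly_eval h v
     ((\<Sum>m\<in>Poly_Mapping.keys P. Poly_Mapping.single m (Poly_Mapping.lookup P m)) *
      (\<Sum>n\<in>Poly_Mapping.keys Q. Poly_Mapping.single n (Poly_Mapping.lookup Q n)))"
    using expand[of P] expand[of Q] by simp
  also have "\<dots> = poly_eval h v P * poly_eval h v Q"
    unfolding sum_product poly_eval_sum mult_single poly_eval_single poly_eval_def[of h v P]
      poly_eval_def[of h v Q]
    by (simp add: hom_mult lookup_add power_add prod.distrib mult_ac)
  finally show ?thesis .
qed

lemma poly_eval_one: "poly_eval h v 1 = 1"
  by (simp add: poly_eval_single hom_one flip: single_one)

end

section \<open>Values of rational functions, as a relation expressing definedness and value
  together\<close>

definition rf_has_value ::
    "(complex \<Rightarrow> 'k :: field) \<Rightarrow> 'k ^ ('n :: {finite, linorder}) \<Rightarrow> 'n ratfun \<Rightarrow> 'k \<Rightarrow> bool" where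
  "rf_has_value h v r w \<longleftrightarrow>
     (\<exists>P Q. r = Fract P Q \<and> poly_eval h v Q \<noteq> 0 \<and> w = poly_eval h v P / poly_eval h v Q)"

lemma rf_defined_iff: "rf_defined h v r \<longleftrightarrow> (\<exists>w. rf_has_value h v r w)"
  by (auto simp: rf_defined_def rf_has_value_def)

text \<open>Lets the introduction rules pass through the case distinctions on the index in
  \<open>Sact\<close>.\<close>

lemma rf_has_value_If:
  assumes "P \<Longrightarrow> rf_has_value h v r w" "\<not> P \<Longrightarrow> rf_has_value h v r' w'"
  shows "rf_has_value h v (if P then r else r') (if P then w else w')"
  using assms by simp

context complex_field_hom
begin

lemma poly_eval_nonzero: "poly_eval h v P \<noteq> 0 \<Longrightarrow> P \<noteq> 0"
  using poly_eval_zero by auto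

text \<open>Denominators that do not vanish at \<open>v\<close> are nonzero polynomials, so two
  representations can be cross-multiplied; evaluating the resulting polynomial identity equates the
  two values. Hence the description in \<open>rf_value\<close> picks out a unique element.\<close>

lemma rf_has_value_unique:
  assumes "rf_has_value h v r w" "rf_has_value h v r w'"
  shows "w = w'"
proof -
  obtain P Q where P: "r = Fract P Q" "poly_eval h v Q \<noteq> 0"
    "w = poly_eval h v P / poly_eval h v Q"
    using assms(1) unfolding rf_has_value_def by blast
  obtain P' Q' where P': "r = Fract P' Q'" "poly_eval h v Q' \<noteq> 0"
    "w' = poly_eval h v P' / poly_eval h v Q'"
    using assms(2) unfolding rf_has_value_def by blast
  have "P * Q' = P' * Q"
    using P(1,2) P'(1,2) poly_eval_nonzero by (metis eq_fract(1))
  then have "poly_eval h v P * poly_eval h v Q' = poly_eval h v P' * poly_eval h v Q"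
    by (metis poly_eval_mult)
  then show ?thesis using P P' by (simp add: frac_eq_eq)
qed

lemma rf_value_eqI: "rf_has_value h v r w \<Longrightarrow> rf_value h v r = w"
  unfolding rf_value_def rf_has_value_def[symmetric]
  by (rule the_equality) (auto intro: rf_has_value_unique)

lemma rf_has_value_rf_value: "rf_defined h v r \<Longrightarrow> rf_has_value h v r (rf_value h v r)"
  using rf_value_eqI rf_defined_iff by metis

lemma rf_has_value_Cst: "rf_has_value h v (Cst c) (h c)"
  unfolding rf_has_value_def Cst_def
  by (rule exI[of _ "Poly_Mapping.single 0 c"], rule exI[of _ 1])
    (simp add: poly_eval_one poly_eval_single)

lemma rf_has_value_Var: "rf_has_value h v (Var i) (v $ i)"
proof -
  have "(\<Prod>j\<in>UNIV. v $ j ^ Poly_Mapping.lookup (Poly_Mapping.single i 1) j) = v $ i"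
    by (simp add: lookup_single when_def if_distrib cong: if_cong)
  then show ?thesis
    unfolding rf_has_value_def Var_def
    by (intro exI[of _ "Poly_Mapping.single (Poly_Mapping.single i 1) 1"] exI[of _ 1])
      (simp add: poly_eval_one poly_eval_single hom_one)
qed

lemma rf_has_value_add:
  assumes "rf_has_value h v r w" "rf_has_value h v r' w'"
  shows "rf_has_value h v (r + r') (w + w')"
proof -
  obtain P Q where P: "r = Fract P Q" "poly_eval h v Q \<noteq> 0"
    "w = poly_eval h v P / poly_eval h v Q"
    using assms(1) unfolding rf_has_value_def by blast
  obtain P' Q' where P': "r' = Fract P' Q'" "poly_eval h v Q' \<noteq> 0"
    "w' = poly_eval h v P' / poly_eval h v Q'"
    using assms(2) unfolding rf_has_value_def by blast
  show ?thesis
    unfolding rf_has_value_def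
    by (rule exI[of _ "P * Q' + P' * Q"], rule exI[of _ "Q * Q'"])
      (use P(2) P'(2) in \<open>simp add: P(1,3) P'(1,3) poly_eval_mult poly_eval_add poly_eval_nonzero add_frac_eq\<close>)
qed

lemma rf_has_value_mult:
  assumes "rf_has_value h v r w" "rf_has_value h v r' w'"
  shows "rf_has_value h v (r * r') (w * w')"
proof -
  obtain P Q where P: "r = Fract P Q" "poly_eval h v Q \<noteq> 0"
    "w = poly_eval h v P / poly_eval h v Q"
    using assms(1) unfolding rf_has_value_def by blast
  obtain P' Q' where P': "r' = Fract P' Q'" "poly_eval h v Q' \<noteq> 0"
    "w' = poly_eval h v P' / poly_eval h v Q'"
    using assms(2) unfolding rf_has_value_def by blast
  show ?thesis
    unfolding rf_has_value_def
    by (rule exI[of _ "P * P'"], rule exI[of _ "Q * Q'"])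
      (use P(2) P'(2) in \<open>simp add: P(1,3) P'(1,3) poly_eval_mult\<close>)
qed

lemma rf_has_value_divide:
  assumes "rf_has_value h v r w" "rf_has_value h v r' w'" "w' \<noteq> 0"
  shows "rf_has_value h v (r / r') (w / w')"
proof -
  obtain P Q where P: "r = Fract P Q" "poly_eval h v Q \<noteq> 0"
    "w = poly_eval h v P / poly_eval h v Q"
    using assms(1) unfolding rf_has_value_def by blast
  obtain P' Q' where P': "r' = Fract P' Q'" "poly_eval h v Q' \<noteq> 0"
    "w' = poly_eval h v P' / poly_eval h v Q'"
    using assms(2) unfolding rf_has_value_def by blast
  \<comment> \<open>Since \<open>w'\<close> is nonzero, the numerator \<open>P'\<close> does not
    vanish at \<open>v\<close> and may move into the denominator.\<close>
  show ?thesis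
    unfolding rf_has_value_def
    by (rule exI[of _ "P * Q'"], rule exI[of _ "Q * P'"])
      (use P(2) P'(2,3) assms(3) in \<open>simp add: P(1,3) P'(1) poly_eval_mult\<close>)
qed

lemma rf_has_value_one: "rf_has_value h v 1 1"
  unfolding rf_has_value_def
  by (rule exI[of _ 1], rule exI[of _ 1]) (simp add: poly_eval_one One_fract_def)

lemma rf_has_value_zero: "rf_has_value h v 0 0"
  unfolding rf_has_value_def
  by (rule exI[of _ 0], rule exI[of _ 1]) (simp add: poly_eval_one poly_eval_zero Zero_fract_def)

lemma rf_has_value_power: "rf_has_value h v r w \<Longrightarrow> rf_has_value h v (r ^ n) (w ^ n)"
  by (induction n) (auto intro: rf_has_value_one rf_has_value_mult)

text \<open>The zero function takes only the value 0, so a single nonzero value certifies a nonzero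
  rational function. The denominators below are tested this way.\<close>

lemma rf_has_value_imp_nonzero: "rf_has_value h v r w \<Longrightarrow> w \<noteq> 0 \<Longrightarrow> r \<noteq> 0"
  using rf_has_value_zero rf_has_value_unique by blast

lemmas rf_has_value_intros = rf_has_value_Cst rf_has_value_Var rf_has_value_one
  rf_has_value_add rf_has_value_mult rf_has_value_divide rf_has_value_power

end

section \<open>The two instances: values at points and substitution of rational functions\<close>

lemma Cst_add: "Cst (x + y) = Cst x + Cst y"
  by (simp add: Cst_def single_add)

lemma Cst_mult: "Cst (x * y) = Cst x * Cst y"
  by (simp add: Cst_def mult_single)

lemma Cst_one: "Cst 1 = 1"
  by (simp add: Cst_def One_fract_def)

interpretation at_point: complex_field_hom id
  by standard auto

interpretation subst: complex_field_hom Cst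
  by standard (auto simp: Cst_add Cst_mult Cst_one)

lemma Cst_nonzero: "c \<noteq> 0 \<Longrightarrow> Cst c \<noteq> 0"
  using at_point.rf_has_value_Cst at_point.rf_has_value_imp_nonzero by (metis id_apply)

lemma Var_nonzero: "Var i \<noteq> 0"
  using at_point.rf_has_value_Var[of "\<chi> _. 1" i] at_point.rf_has_value_imp_nonzero by fastforce

section \<open>Coordinates of six-dimensional space\<close>

lemma forall_6: "(\<forall>i::6. P i) \<longleftrightarrow> P 1 \<and> P 2 \<and> P 3 \<and> P 4 \<and> P 5 \<and> P 6"
proof -
  have "i = 1 \<or> i = 2 \<or> i = 3 \<or> i = 4 \<or> i = 5 \<or> i = 6" for i :: 6
  proof (induct i)
    case (of_int z)
    \<comment> \<open>The representative 0 is the index called 6.\<close>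
    then have "z = 0 \<or> z = 1 \<or> z = 2 \<or> z = 3 \<or> z = 4 \<or> z = 5" by fastforce
    then show ?case by auto
  qed
  then show ?thesis by metis
qed

lemma distinct_6: "distinct [1, 2, 3, 4, 5, 6 :: 6]"
  by simp

lemma distinct_6_triples:
  "distinct [1, 2, 3 :: 6]" "distinct [1, 4, 5 :: 6]" "distinct [2, 4, 6 :: 6]"
  "distinct [3, 5, 6 :: 6]"
  by simp_all

lemma vector_6:
  fixes x1 :: "'a :: zero"
  shows "(vector [x1,x2,x3,x4,x5,x6] :: 'a ^ 6) $ 1 = x1"
   "(vector [x1,x2,x3,x4,x5,x6] :: 'a ^ 6) $ 2 = x2"
   "(vector [x1,x2,x3,x4,x5,x6] :: 'a ^ 6) $ 3 = x3"
   "(vector [x1,x2,x3,x4,x5,x6] :: 'a ^ 6) $ 4 = x4"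
   "(vector [x1,x2,x3,x4,x5,x6] :: 'a ^ 6) $ 5 = x5"
   "(vector [x1,x2,x3,x4,x5,x6] :: 'a ^ 6) $ 6 = x6"
  unfolding vector_def using distinct_6 by simp_all

context complex_field_hom
begin

text \<open>The expression \<open>a y + b x z\<close> factors as \<open>a x D\<close>. This cancels
  the common factors and leaves \<open>D\<close> as the only denominator in the first component and
  as the whole third component.\<close>

lemma rf_has_value_Smap:
  fixes v :: "'k ^ 3"
  assumes "h a \<noteq> 0" "h c \<noteq> 0" "v $ 1 \<noteq> 0" "D = v $ 2 / v $ 1 + h b / h a * v $ 3" "D \<noteq> 0"
  shows "rf_has_value h v (Smap a b c $ 1) (v $ 2 / D)"
    and "rf_has_value h v (Smap a b c $ 2) (h b / (h a * h c) * v $ 1 * v $ 3)"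
    and "rf_has_value h v (Smap a b c $ 3) D"
proof -
  have D: "h a * v $ 2 + h b * v $ 1 * v $ 3 = h a * v $ 1 * D"
    using assms by (simp add: field_simps)
  have "rf_has_value h v (Smap a b c $ 1)
      ((h a * v $ 1 * v $ 2) / (h a * v $ 2 + h b * v $ 1 * v $ 3))"
    unfolding Smap_def Let_def vector_3
    by (intro rf_has_value_intros) (use assms in \<open>simp add: D\<close>)
  then show "rf_has_value h v (Smap a b c $ 1) (v $ 2 / D)"
    using assms(1-3,5) by (simp add: D)
  have "rf_has_value h v (Smap a b c $ 2) ((h b * v $ 1 * v $ 3) / (h a * h c))"
    unfolding Smap_def Let_def vector_3
    by (intro rf_has_value_intros) (use assms in simp)
  then show "rf_has_value h v (Smap a b c $ 2) (h b / (h a * h c) * v $ 1 * v $ 3)"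
    by simp
  have "rf_has_value h v (Smap a b c $ 3)
      ((h a * v $ 2 + h b * v $ 1 * v $ 3) / (h a * v $ 1))"
    unfolding Smap_def Let_def vector_3
    by (intro rf_has_value_intros) (use assms in simp)
  then show "rf_has_value h v (Smap a b c $ 3) D"
    using assms(1-3,5) by (simp add: D)
qed

end

section \<open>Composition with S and its action on three of six factors\<close>

lemma rcomp_eqI:
  assumes "\<forall>i. rf_has_value Cst g (f $ i) (w $ i)"
  shows "composable f g" "f \<circ>\<^sub>r g = w"
  using assms by (auto simp: composable_def rf_defined_iff rcomp_def vec_eq_iff subst.rf_value_eqI)

lemma rcomp_Smap:
  assumes "a \<noteq> 0" "c \<noteq> 0" "g $ 1 \<noteq> 0" "D = g $ 2 / g $ 1 + Cst b / Cst a * g $ 3" "D \<noteq> 0"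
  shows "composable (Smap a b c) g"
    and "Smap a b c \<circ>\<^sub>r g = vector [g $ 2 / D, Cst b / (Cst a * Cst c) * g $ 1 * g $ 3, D]"
proof -
  let ?w = "vector [g $ 2 / D, Cst b / (Cst a * Cst c) * g $ 1 * g $ 3, D] :: ('a, 3) ratmap"
  have "\<forall>i. rf_has_value Cst g (Smap a b c $ i) (?w $ i)"
    unfolding forall_3 vector_3 using assms by (intro conjI subst.rf_has_value_Smap Cst_nonzero)
  then show "composable (Smap a b c) g" "Smap a b c \<circ>\<^sub>r g = ?w"
    by (rule rcomp_eqI)+
qed

text \<open>The expected closed form of the composite of \<open>act_on (Smap a b c) i j k\<close>
  with a tuple \<open>g\<close>. The source of \<open>g\<close> is left arbitrary;
  \<open>g = rid\<close> gives the action itself.\<close>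

definition Sact :: "complex \<Rightarrow> complex \<Rightarrow> complex \<Rightarrow> 6 \<Rightarrow> 6 \<Rightarrow> 6 \<Rightarrow>
    ('n :: {finite, linorder}, 6) ratmap \<Rightarrow> ('n, 6) ratmap" where
  "Sact a b c i j k g =
     (let D = g $ j / g $ i + Cst b / Cst a * g $ k
      in \<chi> l. if l = i then g $ j / D else if l = j then Cst b / (Cst a * Cst c) * g $ i * g $ k
         else if l = k then D else g $ l)"

lemma act_on_Smap:
  assumes "a \<noteq> 0" "c \<noteq> 0" "distinct [i, j, k]"
  shows "act_on (Smap a b c) i j k = Sact a b c i j k rid"
proof -
  define D :: "6 ratfun" where "D = Var j / Var i + Cst b / Cst a * Var k"
  \<comment> \<open>Setting the coordinate \<open>k\<close> to 0 removes the term containing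
    \<open>b\<close>. The distinct coordinates \<open>i\<close> and \<open>j\<close> are 1, so
    \<open>D\<close> takes the value 1 here.\<close>
  let ?p = "(\<chi> l. if l = k then 0 else 1) :: complex ^ 6"
  have "rf_has_value id ?p D (?p $ j / ?p $ i + id b / id a * ?p $ k)"
    unfolding D_def using assms by (intro at_point.rf_has_value_intros) auto
  then have "D \<noteq> 0"
    by (rule at_point.rf_has_value_imp_nonzero) (use assms in auto)
  then have "Smap a b c \<circ>\<^sub>r vector [Var i, Var j, Var k] =
      vector [Var j / D, Cst b / (Cst a * Cst c) * Var i * Var k, D]"
    using assms D_def by (subst rcomp_Smap(2)[where D = D]) (auto simp: Var_nonzero)
  then show ?thesis
    unfolding act_on_def Sact_def Let_def rid_def
    by (simp only: vec_lambda_beta vector_3 flip: D_def)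
qed

text \<open>The components of \<open>Sact\<close> at \<open>rid\<close> are built from variables and
  constants by field operations. Substituting \<open>g\<close> preserves these formulas as long as
  \<open>g $ i\<close> and the substituted denominator are nonzero.\<close>

lemma rcomp_act_on_Smap:
  assumes "a \<noteq> 0" "c \<noteq> 0" "distinct [i, j, k]"
    and "g $ i \<noteq> 0" "g $ j / g $ i + Cst b / Cst a * g $ k \<noteq> 0"
  shows "composable (act_on (Smap a b c) i j k) g"
    and "act_on (Smap a b c) i j k \<circ>\<^sub>r g = Sact a b c i j k g"
proof -
  have "rf_has_value Cst g (Sact a b c i j k rid $ l) (Sact a b c i j k g $ l)" for l
  proof -
    have "rf_has_value Cst g (Var j / Var i + Cst b / Cst a * Var k)
        (g $ j / g $ i + Cst b / Cst a * g $ k)"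
      using assms by (intro subst.rf_has_value_intros Cst_nonzero)
    then show ?thesis
      unfolding Sact_def Let_def rid_def vec_lambda_beta
      by (intro rf_has_value_If subst.rf_has_value_intros assms Cst_nonzero no_zero_divisors)
  qed
  then have "\<forall>l. rf_has_value Cst g (Sact a b c i j k rid $ l) (Sact a b c i j k g $ l)"
    by blast
  then show "composable (act_on (Smap a b c) i j k) g"
    "act_on (Smap a b c) i j k \<circ>\<^sub>r g = Sact a b c i j k g"
    unfolding act_on_Smap[OF assms(1-3)] by (rule rcomp_eqI)+
qed

section \<open>The tetrahedron equation, one factor at a time\<close>

lemma Sact_vector:
  fixes x1 x2 x3 x4 x5 x6 :: "('n :: {finite, linorder}) ratfun"
  shows "D = x2 / x1 + Cst b / Cst a * x3 \<Longrightarrow> Sact a b c 1 2 3 (vector [x1, x2, x3, x4, x5, x6]) =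
      vector [x2 / D, Cst b / (Cst a * Cst c) * x1 * x3, D, x4, x5, x6]"
    and "D = x4 / x1 + Cst b / Cst a * x5 \<Longrightarrow> Sact a b c 1 4 5 (vector [x1, x2, x3, x4, x5, x6]) =
      vector [x4 / D, x2, x3, Cst b / (Cst a * Cst c) * x1 * x5, D, x6]"
    and "D = x4 / x2 + Cst b / Cst a * x6 \<Longrightarrow> Sact a b c 2 4 6 (vector [x1, x2, x3, x4, x5, x6]) =
      vector [x1, x4 / D, x3, Cst b / (Cst a * Cst c) * x2 * x6, x5, D]"
    and "D = x5 / x3 + Cst b / Cst a * x6 \<Longrightarrow> Sact a b c 3 5 6 (vector [x1, x2, x3, x4, x5, x6]) =
      vector [x1, x2, x5 / D, x4, Cst b / (Cst a * Cst c) * x3 * x6, D]"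
  by (simp_all add: Sact_def Let_def vec_eq_iff forall_6 vector_6)

text \<open>One step of either side of the tetrahedron equation. The denominator is a name
  \<open>D\<close> with an equation as premise, so that iterated composites are written with named
  denominators instead of nested fractions.\<close>

lemma rcomp_act_on_Smap_vector:
  fixes x1 x2 x3 x4 x5 x6 :: "('n :: {finite, linorder}) ratfun"
  assumes "a \<noteq> 0" "c \<noteq> 0" "D \<noteq> 0"
  shows "x1 \<noteq> 0 \<Longrightarrow> D = x2 / x1 + Cst b / Cst a * x3 \<Longrightarrow>
      composable (act_on (Smap a b c) 1 2 3) (vector [x1, x2, x3, x4, x5, x6]) \<and>
      act_on (Smap a b c) 1 2 3 \<circ>\<^sub>r vector [x1, x2, x3, x4, x5, x6] =
        vector [x2 / D, Cst b / (Cst a * Cst c) * x1 * x3, D, x4, x5, x6]"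
    and "x1 \<noteq> 0 \<Longrightarrow> D = x4 / x1 + Cst b / Cst a * x5 \<Longrightarrow>
      composable (act_on (Smap a b c) 1 4 5) (vector [x1, x2, x3, x4, x5, x6]) \<and>
      act_on (Smap a b c) 1 4 5 \<circ>\<^sub>r vector [x1, x2, x3, x4, x5, x6] =
        vector [x4 / D, x2, x3, Cst b / (Cst a * Cst c) * x1 * x5, D, x6]"
    and "x2 \<noteq> 0 \<Longrightarrow> D = x4 / x2 + Cst b / Cst a * x6 \<Longrightarrow>
      composable (act_on (Smap a b c) 2 4 6) (vector [x1, x2, x3, x4, x5, x6]) \<and>
      act_on (Smap a b c) 2 4 6 \<circ>\<^sub>r vector [x1, x2, x3, x4, x5, x6] =
        vector [x1, x4 / D, x3, Cst b / (Cst a * Cst c) * x2 * x6, x5, D]"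
    and "x3 \<noteq> 0 \<Longrightarrow> D = x5 / x3 + Cst b / Cst a * x6 \<Longrightarrow>
      composable (act_on (Smap a b c) 3 5 6) (vector [x1, x2, x3, x4, x5, x6]) \<and>
      act_on (Smap a b c) 3 5 6 \<circ>\<^sub>r vector [x1, x2, x3, x4, x5, x6] =
        vector [x1, x2, x5 / D, x4, Cst b / (Cst a * Cst c) * x3 * x6, D]"
  using assms
  by (simp_all only: rcomp_act_on_Smap vector_6 distinct_6_triples Sact_vector[OF refl]
      simp_thms not_False_eq_True)

text \<open>\<open>D1\<close> to \<open>D4\<close> are the denominators met when the factors 123,
  145, 246, 356 act in this order; \<open>E1\<close> to \<open>E4\<close> are those met in the
  reverse order. The identities express \<open>D3\<close>, \<open>D4\<close> and \<open>E4\<close>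
  through the other five denominators.\<close>

lemma tetrahedron_identities:
  fixes a b c d e f x1 x2 x3 x4 x5 x6 :: "'k :: field"
  assumes nz: "a \<noteq> 0" "b \<noteq> 0" "c \<noteq> 0" "d \<noteq> 0" "e \<noteq> 0" "f \<noteq> 0"
    "x1 \<noteq> 0" "x2 \<noteq> 0" "x3 \<noteq> 0" "x4 \<noteq> 0" "x5 \<noteq> 0" "x6 \<noteq> 0"
    and D1: "D1 = x2 / x1 + b / a * x3"
    and D2: "D2 = x4 / (x2 / D1) + d / a * x5"
    and D3: "D3 = d / (a * e) * (x2 / D1) * x5 / (b / (a * c) * x1 * x3) + d / b * x6"
    and D4: "D4 = D2 / D1 + e / c * D3"
    and E1: "E1 = x5 / x3 + e / c * x6"
    and E2: "E2 = x4 / x2 + d / b * E1"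
    and E3: "E3 = d / (b * f) * x2 * E1 / x1 + d / a * (e / (c * f) * x3 * x6)"
    and E4: "E4 = x4 / E2 / (d / (b * f) * x2 * E1 / E3) + b / a * (x5 / E1)"
    and nz': "D1 \<noteq> 0" "E1 \<noteq> 0" "E2 \<noteq> 0" "E3 \<noteq> 0"
  shows "D3 = c * f * E3 / (e * D1)" "D4 = E2" "E4 = D2 / E2"
proof -
  \<comment> \<open>The definitions are first turned into polynomial relations, from which
    \<open>algebra\<close> can derive each identity.\<close>
  have d1: "a * x1 * D1 = a * x2 + b * x1 * x3" using nz D1 by (simp add: field_simps)
  have e1: "c * x3 * E1 = c * x5 + e * x3 * x6" using nz E1 by (simp add: field_simps)
  have e2: "b * x2 * E2 = b * x4 + d * x2 * E1" using nz E2 by (simp add: field_simps)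
  have e3: "a * b * c * f * x1 * E3 = a * c * d * x2 * E1 + b * d * e * x1 * x3 * x6"
    using nz E3 by (simp add: field_simps)
  have d2: "a * x2 * D2 = a * x4 * D1 + d * x2 * x5" using nz nz' D2 by (simp add: field_simps)
  have d3: "b * e * x1 * x3 * D1 * D3 = c * d * x2 * x5 + d * e * x1 * x3 * x6 * D1"
    using nz nz' D3 by (simp add: field_simps)
  have d4: "c * D1 * D4 = c * D2 + e * D1 * D3" using nz nz' D4 by (simp add: field_simps)
  have e4: "a * d * x2 * E1 * E2 * E4 = a * b * f * x4 * E3 + b * d * x2 * x5 * E2"
    using nz nz' E4 by (simp add: field_simps)
  \<comment> \<open>The factor in front supplies the coefficients that \<open>D1\<close>,
    \<open>D3\<close>, \<open>E1\<close> and \<open>E3\<close> carry in the relations. Both sides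
    then reduce to \<open>a c d x2 x5 + d e x3 x6 (a x2 + b x1 x3)\<close>. The other two identities
    are likewise proved after multiplication by a nonzero factor.\<close>
  have "a * b * x1 * x3 * (e * D1 * D3) = a * b * x1 * x3 * (c * f * E3)"
    using d1 e1 e3 d3 by algebra
  then have "e * D1 * D3 = c * f * E3"
    using nz by simp
  then show "D3 = c * f * E3 / (e * D1)"
    using nz nz' by (simp add: field_simps)
  have "a * b * x1 * x2 * x3 * (c * D1 * D4) = a * b * x1 * x2 * x3 * (c * D1 * E2)"
    using d1 d2 d3 d4 e1 e2 by algebra
  then show "D4 = E2"
    using nz nz' by simp
  have "a * c * x1 * x2 * x3 * (a * d * x2 * E1 * E2 * E4) =
      a * c * x1 * x2 * x3 * (a * d * x2 * E1 * D2)"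
    using d1 d2 e1 e2 e3 e4 by algebra
  then have "E2 * E4 = D2"
    using nz nz' by simp
  then show "E4 = D2 / E2"
    using nz' by (simp add: field_simps)
qed

lemma parametric_tetrahedron_map_Smap: "parametric_tetrahedron_map (- {0}) Smap"
proof -
  {
    fix a b c d e f :: complex
    assume nz: "a \<noteq> 0" "b \<noteq> 0" "c \<noteq> 0" "d \<noteq> 0" "e \<noteq> 0" "f \<noteq> 0"
    define S123 where "S123 = act_on (Smap a b c) 1 2 3"
    define S145 where "S145 = act_on (Smap a d e) 1 4 5"
    define S246 where "S246 = act_on (Smap b d f) 2 4 6"
    define S356 where "S356 = act_on (Smap c e f) 3 5 6"
    define x1 x2 x3 x4 x5 x6 :: "6 ratfun"
      where x: "x1 = Var 1" "x2 = Var 2" "x3 = Var 3" "x4 = Var 4" "x5 = Var 5" "x6 = Var 6"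
    let ?A = "Cst a :: 6 ratfun" and ?B = "Cst b :: 6 ratfun" and ?C = "Cst c :: 6 ratfun"
    let ?D = "Cst d :: 6 ratfun" and ?E = "Cst e :: 6 ratfun" and ?F = "Cst f :: 6 ratfun"
    have x_nz: "x1 \<noteq> 0" "x2 \<noteq> 0" "x3 \<noteq> 0" "x4 \<noteq> 0" "x5 \<noteq> 0" "x6 \<noteq> 0"
      by (simp_all add: x Var_nonzero)
    have A_nz: "?A \<noteq> 0" "?B \<noteq> 0" "?C \<noteq> 0" "?D \<noteq> 0" "?E \<noteq> 0" "?F \<noteq> 0"
      using nz by (simp_all add: Cst_nonzero)
    define D1 where "D1 = x2 / x1 + ?B / ?A * x3"
    define D2 where "D2 = x4 / (x2 / D1) + ?D / ?A * x5"
    define D3 where "D3 = ?D / (?A * ?E) * (x2 / D1) * x5 / (?B / (?A * ?C) * x1 * x3) + ?D / ?B * x6"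
    define D4 where "D4 = D2 / D1 + ?E / ?C * D3"
    define E1 where "E1 = x5 / x3 + ?E / ?C * x6"
    define E2 where "E2 = x4 / x2 + ?D / ?B * E1"
    define E3 where "E3 = ?D / (?B * ?F) * x2 * E1 / x1 + ?D / ?A * (?E / (?C * ?F) * x3 * x6)"
    define E4 where "E4 = x4 / E2 / (?D / (?B * ?F) * x2 * E1 / E3) + ?B / ?A * (x5 / E1)"
    note defs = D1_def D2_def D3_def D4_def E1_def E2_def E3_def E4_def
    \<comment> \<open>At this point the summands of each denominator become positive integers times
      a common monomial in the parameters: \<open>D1\<close>, \<open>D2\<close>, \<open>E1\<close>,
      \<open>E2\<close>, \<open>E3\<close> take the values 2, 3, \<open>2 b / d\<close>, 3,
      \<open>3 / f\<close>.\<close>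
    define p :: "complex ^ 6" where "p = vector [1, 1, a / b, 1, a / d, b * c / (d * e)]"
    have hx: "rf_has_value id p x1 1" "rf_has_value id p x2 1" "rf_has_value id p x3 (a / b)"
      "rf_has_value id p x4 1" "rf_has_value id p x5 (a / d)"
      "rf_has_value id p x6 (b * c / (d * e))"
      using at_point.rf_has_value_Var[of p 1] at_point.rf_has_value_Var[of p 2]
        at_point.rf_has_value_Var[of p 3] at_point.rf_has_value_Var[of p 4]
        at_point.rf_has_value_Var[of p 5] at_point.rf_has_value_Var[of p 6]
      by (simp_all only: x p_def vector_6)
    have hA: "rf_has_value id p ?A a" "rf_has_value id p ?B b" "rf_has_value id p ?C c"
      "rf_has_value id p ?D d" "rf_has_value id p ?E e" "rf_has_value id p ?F f"
      using at_point.rf_has_value_Cst[of p] by auto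
    note hv = hx hA at_point.rf_has_value_add at_point.rf_has_value_mult at_point.rf_has_value_divide
    have "rf_has_value id p D1 (1 / 1 + b / a * (a / b))"
      unfolding D1_def by (intro hv) (use nz in simp_all)
    then have hD1: "rf_has_value id p D1 2" using nz by simp
    have "rf_has_value id p D2 (1 / (1 / 2) + d / a * (a / d))"
      unfolding D2_def by (intro hv hD1) (use nz in simp_all)
    then have hD2: "rf_has_value id p D2 3" using nz by simp
    have "rf_has_value id p E1 (a / d / (a / b) + e / c * (b * c / (d * e)))"
      unfolding E1_def by (intro hv) (use nz in simp_all)
    then have hE1: "rf_has_value id p E1 (2 * b / d)" using nz by (simp add: field_simps)
    have "rf_has_value id p E2 (1 / 1 + d / b * (2 * b / d))"
      unfolding E2_def by (intro hv hE1) (use nz in simp_all)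
    then have hE2: "rf_has_value id p E2 3" using nz by simp
    have "rf_has_value id p E3
        (d / (b * f) * 1 * (2 * b / d) / 1 + d / a * (e / (c * f) * (a / b) * (b * c / (d * e))))"
      unfolding E3_def by (intro hv hE1) (use nz in simp_all)
    then have hE3: "rf_has_value id p E3 (3 / f)" using nz by (simp add: field_simps)
    have D_nz: "D1 \<noteq> 0" "D2 \<noteq> 0" "E1 \<noteq> 0" "E2 \<noteq> 0" "E3 \<noteq> 0"
      using hD1[THEN at_point.rf_has_value_imp_nonzero] hD2[THEN at_point.rf_has_value_imp_nonzero]
        hE1[THEN at_point.rf_has_value_imp_nonzero] hE2[THEN at_point.rf_has_value_imp_nonzero]
        hE3[THEN at_point.rf_has_value_imp_nonzero] nz by auto
    have ids: "D3 = ?C * ?F * E3 / (?E * D1)" "D4 = E2" "E4 = D2 / E2"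
      using tetrahedron_identities[OF A_nz x_nz defs D_nz(1,3-5)] .
    \<comment> \<open>By the identities these three arise by multiplication and division from
      nonzero constants and the denominators already tested at \<open>p\<close>.\<close>
    have D_nz': "D3 \<noteq> 0" "D4 \<noteq> 0" "E4 \<noteq> 0"
      unfolding ids using A_nz D_nz by auto
    have rid: "rid = vector [x1, x2, x3, x4, x5, x6]"
      by (simp add: rid_def vec_eq_iff forall_6 vector_6 x)
    have S123: "S123 = vector [x2 / D1, ?B / (?A * ?C) * x1 * x3, D1, x4, x5, x6]"
      unfolding S123_def act_on_Smap[OF nz(1) nz(3) distinct_6_triples(1)] rid
      by (rule Sact_vector(1)[OF D1_def])
    have S356: "S356 = vector [x1, x2, x5 / E1, x4, ?E / (?C * ?F) * x3 * x6, E1]"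
      unfolding S356_def act_on_Smap[OF nz(3) nz(6) distinct_6_triples(4)] rid
      by (rule Sact_vector(4)[OF E1_def])
    \<comment> \<open>\<open>R2\<close> to \<open>R4\<close> build the right side from
      \<open>S123\<close>. Composition associates to the right, so each stage applies one more
      factor to an explicit tuple and meets the next denominator.\<close>
    have R2: "composable S145 S123 \<and>
       S145 \<circ>\<^sub>r S123 = vector [x4 / D2, ?B / (?A * ?C) * x1 * x3, D1,
         ?D / (?A * ?E) * (x2 / D1) * x5, D2, x6]"
      unfolding S123 S145_def
      by (rule rcomp_act_on_Smap_vector(2)[OF nz(1) nz(5) D_nz(2) _ D2_def])
        (simp add: A_nz x_nz D_nz)
    have R3: "composable S246 (S145 \<circ>\<^sub>r S123) \<and>
       S246 \<circ>\<^sub>r S145 \<circ>\<^sub>r S123 = vector [x4 / D2, ?D / (?A * ?E) * (x2 / D1) * x5 / D3, D1,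
         ?D / (?B * ?F) * (?B / (?A * ?C) * x1 * x3) * x6, D2, D3]"
      unfolding R2[THEN conjunct2] S246_def
      by (rule rcomp_act_on_Smap_vector(3)[OF nz(2) nz(6) D_nz'(1) _ D3_def])
        (simp add: A_nz x_nz D_nz)
    have R4: "composable S356 (S246 \<circ>\<^sub>r S145 \<circ>\<^sub>r S123) \<and>
       S356 \<circ>\<^sub>r S246 \<circ>\<^sub>r S145 \<circ>\<^sub>r S123 = vector [x4 / D2, ?D / (?A * ?E) * (x2 / D1) * x5 / D3,
         D2 / D4, ?D / (?B * ?F) * (?B / (?A * ?C) * x1 * x3) * x6, ?E / (?C * ?F) * D1 * D3, D4]"
      unfolding R3[THEN conjunct2] S356_def
      by (rule rcomp_act_on_Smap_vector(4)[OF nz(3) nz(6) D_nz'(2) _ D4_def])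
        (simp add: A_nz x_nz D_nz)
    \<comment> \<open>\<open>L2\<close> to \<open>L4\<close> build the left side from
      \<open>S356\<close> in the same way.\<close>
    have L2: "composable S246 S356 \<and>
       S246 \<circ>\<^sub>r S356 = vector [x1, x4 / E2, x5 / E1, ?D / (?B * ?F) * x2 * E1,
         ?E / (?C * ?F) * x3 * x6, E2]"
      unfolding S356 S246_def
      by (rule rcomp_act_on_Smap_vector(3)[OF nz(2) nz(6) D_nz(4) _ E2_def])
        (simp add: A_nz x_nz D_nz)
    have L3: "composable S145 (S246 \<circ>\<^sub>r S356) \<and>
       S145 \<circ>\<^sub>r S246 \<circ>\<^sub>r S356 = vector [?D / (?B * ?F) * x2 * E1 / E3, x4 / E2, x5 / E1,
         ?D / (?A * ?E) * x1 * (?E / (?C * ?F) * x3 * x6), E3, E2]"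
      unfolding L2[THEN conjunct2] S145_def
      by (rule rcomp_act_on_Smap_vector(2)[OF nz(1) nz(5) D_nz(5) _ E3_def])
        (simp add: A_nz x_nz D_nz)
    have L4: "composable S123 (S145 \<circ>\<^sub>r S246 \<circ>\<^sub>r S356) \<and>
       S123 \<circ>\<^sub>r S145 \<circ>\<^sub>r S246 \<circ>\<^sub>r S356 = vector [x4 / E2 / E4,
         ?B / (?A * ?C) * (?D / (?B * ?F) * x2 * E1 / E3) * (x5 / E1), E4,
         ?D / (?A * ?E) * x1 * (?E / (?C * ?F) * x3 * x6), E3, E2]"
      unfolding L3[THEN conjunct2] S123_def
      by (rule rcomp_act_on_Smap_vector(1)[OF nz(1) nz(3) D_nz'(3) _ E4_def])
        (simp add: A_nz x_nz D_nz)
    \<comment> \<open>Once \<open>ids\<close> eliminates \<open>D3\<close>, \<open>D4\<close> and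
      \<open>E4\<close>, the components agree with the other five denominators treated as
      independent symbols.\<close>
    have "S123 \<circ>\<^sub>r S145 \<circ>\<^sub>r S246 \<circ>\<^sub>r S356 = S356 \<circ>\<^sub>r S246 \<circ>\<^sub>r S145 \<circ>\<^sub>r S123"
      unfolding L4[THEN conjunct2] R4[THEN conjunct2] ids using A_nz x_nz D_nz
      by (simp add: vec_eq_iff forall_6 vector_6 field_simps)
    note this L2[THEN conjunct1] L3[THEN conjunct1] L4[THEN conjunct1]
      R2[THEN conjunct1] R3[THEN conjunct1] R4[THEN conjunct1]
  }
  then show ?thesis
    unfolding parametric_tetrahedron_map_def Let_def by auto
qed

section \<open>Noninvolutivity of S\<close>

lemma noninvolutive_Smap:
  assumes nz: "a \<noteq> 0" "b \<noteq> 0" "c \<noteq> 0"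
  shows "noninvolutive (Smap a b c)"
proof -
  define x y z :: "3 ratfun" where x: "x = Var 1" "y = Var 2" "z = Var 3"
  define A B C :: "3 ratfun" where A: "A = Cst a" "B = Cst b" "C = Cst c"
  have x_nz: "x \<noteq> 0" "y \<noteq> 0" "z \<noteq> 0" and A_nz: "A \<noteq> 0" "B \<noteq> 0" "C \<noteq> 0"
    using nz by (simp_all add: x A Var_nonzero Cst_nonzero)
  define D where "D = y / x + B / A * z"
  define w where "w = x * z / y + C"
  \<comment> \<open>Here \<open>z\<close> vanishes while \<open>D\<close> and \<open>w\<close> take
    the nonzero values 1 and \<open>c\<close>.\<close>
  define p :: "complex ^ 3" where "p = vector [1, 1, 0]"
  have hx: "rf_has_value id p x 1" "rf_has_value id p y 1" "rf_has_value id p z 0"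
    using at_point.rf_has_value_Var[of p 1] at_point.rf_has_value_Var[of p 2]
      at_point.rf_has_value_Var[of p 3]
    by (simp_all only: x p_def vector_3)
  have hA: "rf_has_value id p A a" "rf_has_value id p B b" "rf_has_value id p C c"
    using at_point.rf_has_value_Cst[of p] unfolding A by auto
  note hv = hx hA at_point.rf_has_value_add at_point.rf_has_value_mult at_point.rf_has_value_divide
  have "rf_has_value id p D (1 / 1 + b / a * 0)"
    unfolding D_def by (intro hv) (use nz in simp_all)
  then have hD: "rf_has_value id p D 1" by simp
  have "rf_has_value id p w (1 * 0 / 1 + c)"
    unfolding w_def by (intro hv) (use nz in simp_all)
  then have hw: "rf_has_value id p w c" by simp
  have D_nz: "D \<noteq> 0" "w \<noteq> 0"
    using at_point.rf_has_value_imp_nonzero[OF hD] at_point.rf_has_value_imp_nonzero[OF hw] nz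
    by auto
  have S: "Smap a b c = vector [y / D, B / (A * C) * x * z, D]"
  proof -
    have "A * y + B * x * z = A * x * D"
      using x_nz A_nz by (simp add: D_def field_simps)
    then show ?thesis
      using x_nz A_nz D_nz
      by (simp add: Smap_def Let_def vec_eq_iff forall_3 flip: x A)
  qed
  \<comment> \<open>\<open>D'\<close> is the denominator of the second application of S. The
    factored form shows that it is nonzero.\<close>
  define D' where "D' = B / (A * C) * D * w"
  have D': "D' = B / (A * C) * x * z / (y / D) + B / A * D"
    using x_nz A_nz D_nz by (simp add: D'_def w_def field_simps)
  have D'_nz: "D' \<noteq> 0" using A_nz D_nz by (simp add: D'_def)
  have comp: "composable (Smap a b c) (Smap a b c)"
    "Smap a b c \<circ>\<^sub>r Smap a b c =
      vector [Smap a b c $ 2 / D', Cst b / (Cst a * Cst c) * Smap a b c $ 1 * Smap a b c $ 3, D']"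
    by (rule rcomp_Smap; use nz x_nz D_nz D'_nz in \<open>simp add: S D' flip: A\<close>)+
  have "Smap a b c \<circ>\<^sub>r Smap a b c \<noteq> rid"
  proof
    assume "Smap a b c \<circ>\<^sub>r Smap a b c = rid"
    then have "(Smap a b c \<circ>\<^sub>r Smap a b c) $ 1 = rid $ 1" by simp
    then have "B / (A * C) * x * z / D' = x"
      unfolding comp(2) by (simp add: S rid_def flip: x)
    \<comment> \<open>Inserting the factored \<open>D'\<close> cancels \<open>x\<close> and the
      constants; at \<open>p\<close> the two sides have the values 0 and \<open>c\<close>.\<close>
    then have "z = D * w"
      using x_nz A_nz D_nz by (simp add: D'_def field_simps)
    moreover have "rf_has_value id p (D * w) (1 * c)"
      by (intro hv hD hw)
    ultimately show False
      using hx(3) nz at_point.rf_has_value_unique by fastforce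
  qed
  then show ?thesis using comp(1) by (simp add: noninvolutive_def)
qed

section \<open>The invariants and their level set\<close>

lemma invariants_of_Inv: "invariants_of Inv (Tmap a b c)"
proof -
  let ?T = "Tmap a b c"
  \<comment> \<open>The map exchanges x1 and y1 and sends z1 to y1 z1 / x1. Thus y1 z1 becomes x1
    (y1 z1 / x1), and x1 / z1 becomes y1 / (y1 z1 / x1), both unchanged.\<close>
  have T: "?T $ 1 = Var 3" "?T $ 3 = Var 1" "?T $ 5 = Var 3 * Var 5 / Var 1"
    by (simp_all add: Tmap_def Let_def vector_6)
  have "rf_has_value Cst ?T (Inv $ 1) (?T $ 1 + ?T $ 3)"
    "rf_has_value Cst ?T (Inv $ 2) (?T $ 3 * ?T $ 5)"
    "rf_has_value Cst ?T (Inv $ 3) (?T $ 1 / ?T $ 5)"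
    unfolding Inv_def Let_def vector_3
    by (intro subst.rf_has_value_intros; simp add: T Var_nonzero)+
  then have "\<forall>i. rf_has_value Cst ?T (Inv $ i) (Inv $ i)"
    by (simp add: forall_3 T Inv_def Let_def Var_nonzero add.commute)
  then show ?thesis
    unfolding invariants_of_def by (intro conjI rcomp_eqI)
qed

lemma regular_valueI:
  assumes "\<forall>i. rf_has_value id p (f $ i) (w $ i)"
  shows "regular_at f p" "value_at f p = w"
  using assms by (auto simp: regular_at_def rf_defined_iff value_at_def vec_eq_iff at_point.rf_value_eqI)

lemma regular_value_vector_3:
  assumes "rf_has_value id p r1 w1" "rf_has_value id p r2 w2" "rf_has_value id p r3 w3"
  shows "regular_at (vector [r1, r2, r3] :: (_, 3) ratmap) p"
    "value_at (vector [r1, r2, r3] :: (_, 3) ratmap) p = vector [w1, w2, w3]"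
proof -
  have "\<forall>i. rf_has_value id p ((vector [r1, r2, r3] :: (_, 3) ratmap) $ i) (vector [w1, w2, w3] $ i)"
    using assms by (simp add: forall_3)
  then show "regular_at (vector [r1, r2, r3] :: (_, 3) ratmap) p"
    "value_at (vector [r1, r2, r3] :: (_, 3) ratmap) p = vector [w1, w2, w3]"
    by (rule regular_valueI)+
qed

text \<open>These constants give the quadratic a double root with x1 = y1. The level set is
  therefore a single affine space, and the exchange of x1 and y1 acts trivially on it.\<close>

lemma level_set_Inv: "level_set Inv (vector [2, 1, 1]) = {p. p $ 1 = 1 \<and> p $ 3 = 1 \<and> p $ 5 = 1}"
proof (intro set_eqI iffI CollectI)
  fix p assume "p \<in> {p :: complex ^ 6. p $ 1 = 1 \<and> p $ 3 = 1 \<and> p $ 5 = 1}"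
  then have p: "p $ 1 = 1" "p $ 3 = 1" "p $ 5 = 1" by auto
  have "rf_has_value id p (Var 1 + Var 3) (p $ 1 + p $ 3)"
    "rf_has_value id p (Var 3 * Var 5) (p $ 3 * p $ 5)"
    "rf_has_value id p (Var 1 / Var 5) (p $ 1 / p $ 5)"
    by (intro at_point.rf_has_value_intros; simp add: p)+
  from regular_value_vector_3[OF this] show "p \<in> level_set Inv (vector [2, 1, 1])"
    by (simp add: level_set_def Inv_def Let_def p)
next
  fix p :: "complex ^ 6"
  assume "p \<in> level_set Inv (vector [2, 1, 1])"
  then have reg: "regular_at Inv p" and val: "value_at Inv p = vector [2, 1, 1]"
    by (auto simp: level_set_def)
  have "rf_has_value id p (Inv $ i) (value_at Inv p $ i)" for i
    using reg by (simp add: regular_at_def value_at_def at_point.rf_has_value_rf_value)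
  from this[of 1] this[of 2] this[of 3] have
    v: "rf_has_value id p (Var 1 + Var 3) 2" "rf_has_value id p (Var 3 * Var 5) 1"
      "rf_has_value id p (Var 1 / Var 5) 1"
    unfolding val by (simp_all add: Inv_def Let_def)
  have "rf_has_value id p (Var 1 + Var 3) (p $ 1 + p $ 3)"
    "rf_has_value id p (Var 3 * Var 5) (p $ 3 * p $ 5)"
    by (intro at_point.rf_has_value_intros)+
  then have p13: "p $ 1 + p $ 3 = 2" and p35: "p $ 3 * p $ 5 = 1"
    using v at_point.rf_has_value_unique by blast+
  \<comment> \<open>Regularity of the third invariant only provides some representation with
    nonvanishing denominator. That z1 itself is nonzero follows from y1 z1 = 1 and permits
    evaluating x1 / z1 as a quotient.\<close>
  then have p5: "p $ 5 \<noteq> 0" by auto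
  then have "rf_has_value id p (Var 1 / Var 5) (p $ 1 / p $ 5)"
    by (intro at_point.rf_has_value_intros)
  then have "p $ 1 / p $ 5 = 1"
    using v at_point.rf_has_value_unique by blast
  then have p15: "p $ 1 = p $ 5" using p5 by simp
  have p3: "p $ 3 = 2 - p $ 1" using p13 by (simp add: algebra_simps)
  have "(p $ 1 - 1)\<^sup>2 = 1 - p $ 3 * p $ 5"
    unfolding p3 p15[symmetric] by (simp add: power2_eq_square algebra_simps)
  then have "p $ 1 = 1" by (simp add: p35)
  then show "p $ 1 = 1 \<and> p $ 3 = 1 \<and> p $ 5 = 1"
    using p13 p15 by auto
qed

section \<open>Coordinates on the level set and the restriction of T\<close>

definition level_param :: "(3, 6) ratmap" where
  "level_param = vector [1, Var 1, 1, Var 2, 1, Var 3]"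

definition level_coord :: "(6, 3) ratmap" where
  "level_coord = vector [Var 2, Var 4, Var 6]"

lemma coordinates_level_set: "coordinates_on (level_set Inv (vector [2, 1, 1])) level_param level_coord"
proof -
  have *: "\<forall>i. rf_has_value id u (level_param $ i) ((vector [1, u $ 1, 1, u $ 2, 1, u $ 3] :: complex ^ 6) $ i)"
    for u
    unfolding level_param_def forall_6 vector_6 by (intro conjI at_point.rf_has_value_intros)
  have \<phi>: "regular_at level_param u" "value_at level_param u = vector [1, u $ 1, 1, u $ 2, 1, u $ 3]" for u
    by (rule regular_valueI[OF *])+
  have \<psi>: "regular_at level_coord p" "value_at level_coord p = vector [p $ 2, p $ 4, p $ 6]" for p
    unfolding level_coord_def by (rule regular_value_vector_3; rule at_point.rf_has_value_Var)+
  show ?thesis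
    unfolding coordinates_on_def
    by (simp add: \<phi> \<psi> level_set_Inv vector_6 vec_eq_iff forall_3 forall_6)
qed

lemma Tmap_restricts:
  assumes nz: "a \<noteq> 0" "b \<noteq> 0" "c \<noteq> 0"
  shows "restricts_to (Tmap a b c) (level_set Inv (vector [2, 1, 1])) level_param level_coord (Smap a b c)"
proof -
  \<comment> \<open>Membership concerns only the components 1, 3 and 5, which are y1, x1 and y1 z1 /
    x1; all equal 1 on the level set.\<close>
  have L: "value_at (Tmap a b c) p \<in> level_set Inv (vector [2, 1, 1])"
    if "p \<in> level_set Inv (vector [2, 1, 1])" for p
  proof -
    have p: "p $ 1 = 1" "p $ 3 = 1" "p $ 5 = 1" using that by (auto simp: level_set_Inv)
    have "rf_has_value id p (Var 3 * Var 5 / Var 1) (p $ 3 * p $ 5 / p $ 1)"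
      "rf_has_value id p (Var 3) (p $ 3)" "rf_has_value id p (Var 1) (p $ 1)"
      by (intro at_point.rf_has_value_intros; simp add: p)+
    then show ?thesis
      by (simp add: level_set_Inv value_at_def Tmap_def Let_def vector_6 at_point.rf_value_eqI p)
  qed
  let ?D = "Cst a * Var 2 + Cst b * Var 1 * Var 3 :: 3 ratfun"
  \<comment> \<open>At (1, 1, 0) the term with \<open>b\<close> vanishes and \<open>?D\<close> takes
    the value \<open>a\<close>.\<close>
  have "rf_has_value id (vector [1, 1, 0]) ?D
      (a * (vector [1, 1, 0] :: complex ^ 3) $ 2 +
        b * (vector [1, 1, 0] :: complex ^ 3) $ 1 * (vector [1, 1, 0] :: complex ^ 3) $ 3)"
    using at_point.rf_has_value_Cst
    by (intro at_point.rf_has_value_intros) auto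
  then have D: "?D \<noteq> 0"
    by (rule at_point.rf_has_value_imp_nonzero) (use nz in simp)
  let ?w = "vector [1, Smap a b c $ 1, 1, Smap a b c $ 2, 1, Smap a b c $ 3] :: (3, 6) ratmap"
  have \<phi>: "level_param $ 1 = 1" "level_param $ 2 = Var 1" "level_param $ 3 = 1" "level_param $ 4 = Var 2" "level_param $ 5 = 1" "level_param $ 6 = Var 3"
    by (simp_all add: level_param_def vector_6)
  have T: "rf_has_value Cst level_param (Tmap a b c $ 1) (level_param $ 3)"
    "rf_has_value Cst level_param (Tmap a b c $ 2) ((Cst a * (level_param $ 1)\<^sup>2 * level_param $ 2 * level_param $ 4) /
      ((Cst a * level_param $ 3 * level_param $ 4 + Cst b * (level_param $ 1)\<^sup>2 * level_param $ 2 * level_param $ 6) * level_param $ 5))"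
    "rf_has_value Cst level_param (Tmap a b c $ 3) (level_param $ 1)"
    "rf_has_value Cst level_param (Tmap a b c $ 4) ((Cst b * level_param $ 2 * level_param $ 5 * level_param $ 6) / (Cst a * Cst c))"
    "rf_has_value Cst level_param (Tmap a b c $ 5) (level_param $ 3 * level_param $ 5 / level_param $ 1)"
    "rf_has_value Cst level_param (Tmap a b c $ 6)
      ((Cst a * level_param $ 3 * level_param $ 4 + Cst b * (level_param $ 1)\<^sup>2 * level_param $ 2 * level_param $ 6) /
        (Cst a * level_param $ 1 * level_param $ 2 * level_param $ 3))"
    unfolding Tmap_def Let_def vector_6
    by (intro subst.rf_has_value_intros; simp add: \<phi> D nz Cst_nonzero Var_nonzero)+
  \<comment> \<open>With x1 = y1 = z1 = 1 the components 2, 4 and 6 of T are literally the three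
    components of S.\<close>
  then have T': "\<forall>i. rf_has_value Cst level_param (Tmap a b c $ i) (?w $ i)"
    by (simp add: forall_6 vector_6 \<phi> Smap_def Let_def)
  then have comp: "composable (Tmap a b c) level_param" and w: "Tmap a b c \<circ>\<^sub>r level_param = ?w"
    by (rule rcomp_eqI)+
  have "\<forall>i. rf_has_value Cst ?w (level_coord $ i)
      ((vector [?w $ 2, ?w $ 4, ?w $ 6] :: (3, 3) ratmap) $ i)"
    unfolding level_coord_def forall_3 vector_3 by (intro conjI subst.rf_has_value_Var)
  moreover have "(vector [?w $ 2, ?w $ 4, ?w $ 6] :: (3, 3) ratmap) = Smap a b c"
    by (simp add: vec_eq_iff forall_3 vector_6)
  ultimately have "\<forall>i. rf_has_value Cst ?w (level_coord $ i) (Smap a b c $ i)"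
    by simp
  then have "composable level_coord ?w" "level_coord \<circ>\<^sub>r ?w = Smap a b c"
    by (rule rcomp_eqI)+
  then show ?thesis
    unfolding restricts_to_def using L comp by (simp add: w)
qed

theorem proposition5p7:
  shows "(\<forall>a b c :: complex. a \<noteq> 0 \<and> b \<noteq> 0 \<and> c \<noteq> 0 \<longrightarrow> invariants_of Inv (Tmap a b c)) \<and>
    (\<exists>(k :: complex ^ 3) (\<phi> :: (3, 6) ratmap) (\<psi> :: (6, 3) ratmap).
       coordinates_on (level_set Inv k) \<phi> \<psi> \<and>
       (\<forall>a b c :: complex. a \<noteq> 0 \<and> b \<noteq> 0 \<and> c \<noteq> 0 \<longrightarrow>
          restricts_to (Tmap a b c) (level_set Inv k) \<phi> \<psi> (Smap a b c))) \<and>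
    parametric_tetrahedron_map (- {0}) Smap \<and>
    (\<forall>a b c :: complex. a \<noteq> 0 \<and> b \<noteq> 0 \<and> c \<noteq> 0 \<longrightarrow> noninvolutive (Smap a b c))"
  by (intro conjI exI[of _ "vector [2, 1, 1]"] exI[of _ level_param] exI[of _ level_coord] allI impI
      invariants_of_Inv coordinates_level_set Tmap_restricts parametric_tetrahedron_map_Smap
      noninvolutive_Smap; simp)

end
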